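(* If $A$ is $2$--r--cohesive, then $0'' <_T A'$.
   Context: A $2$--coloring of $[\omega]^2$ (the $2$--element subsets of $\omega$) is a function $\mathcal{C}:[\omega]^2\to\{0,1\}$; it is computable if it is computable under a standard coding. $A$ is almost homogeneous for $\mathcal{C}$ if there is a finite $F$ such that $\mathcal{C}$ is constant on $[A\setminus F]^2$. An infinite set $A$ is $2$--r--cohesive if it is almost homogeneous for every computable $2$--coloring of $[\omega]^2$. $0''$ is the double jump of $\emptyset$ and $A'$ is the jump of $A$; $X <_T Y$ means $X \le_T Y$ and $Y \not\le_T X$. *)

theory Defs
  imports Complex_Main "HOL-Library.Nat_Bijection" "HOL-Library.Ramsey"
begin

section \<open>Oracle computability\<close>

text \<open>
  Programs for the partial recursive functions relative to an oracle. All functions are unary;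
  several arguments are passed as one, through the Cantor pairing function \<open>prod_encode\<close>.
  The identity is \<open>Pair Fst Snd\<close>, because the pairing function is onto.
\<close>

datatype prog =
    Zero
  | Succ
  | Fst
  | Snd
  | Oracle
  | Pair prog prog
  | Comp prog prog
  | Prec prog prog
  | Mu prog

text \<open>
  \<open>run X p x = None\<close> means that \<open>p\<close> with oracle \<open>X\<close> diverges on \<open>x\<close>.
  \<open>Prec p q\<close> is the function \<open>h\<close> with \<open>h (a, 0) = p a\<close> and
  \<open>h (a, k + 1) = q (a, (k, h (a, k)))\<close>. \<open>Mu p\<close> sends \<open>x\<close> to the least \<open>n\<close> with
  \<open>p (x, n) = 0\<close>, provided that \<open>p (x, m)\<close> converges for every \<open>m < n\<close>.
\<close>

primrec run :: "nat set \<Rightarrow> prog \<Rightarrow> nat \<Rightarrow> nat option" where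
  "run X Zero = (\<lambda>x. Some 0)"
| "run X Succ = (\<lambda>x. Some (Suc x))"
| "run X Fst = (\<lambda>x. Some (fst (prod_decode x)))"
| "run X Snd = (\<lambda>x. Some (snd (prod_decode x)))"
| "run X Oracle = (\<lambda>x. Some (of_bool (x \<in> X)))"
| "run X (Pair p q) = (\<lambda>x.
     Option.bind (run X p x) (\<lambda>a. Option.bind (run X q x) (\<lambda>b. Some (prod_encode (a, b)))))"
| "run X (Comp p q) = (\<lambda>x. Option.bind (run X q x) (run X p))"
| "run X (Prec p q) = (\<lambda>x. case prod_decode x of (a, n) \<Rightarrow>
     rec_nat (run X p a)
       (\<lambda>k r. Option.bind r (\<lambda>v. run X q (prod_encode (a, prod_encode (k, v))))) n)"
| "run X (Mu p) = (\<lambda>x.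
     if \<exists>n. run X p (prod_encode (x, n)) = Some 0 \<and>
            (\<forall>m<n. run X p (prod_encode (x, m)) \<noteq> None)
     then Some (LEAST n. run X p (prod_encode (x, n)) = Some 0)
     else None)"

text \<open>A Goedel numbering; it is a bijection, so every number is the index of exactly one program.\<close>

primrec index :: "prog \<Rightarrow> nat" where
  "index Zero = 0"
| "index Succ = 1"
| "index Fst = 2"
| "index Snd = 3"
| "index Oracle = 4"
| "index (Pair p q) = 5 + 4 * prod_encode (index p, index q)"
| "index (Comp p q) = 6 + 4 * prod_encode (index p, index q)"
| "index (Prec p q) = 7 + 4 * prod_encode (index p, index q)"
| "index (Mu p) = 8 + 4 * index p"

lemma bij_index: "bij index"
proof (rule bijI)
  show "inj index"
  proof (rule injI)
    fix p q show "index p = index q \<Longrightarrow> p = q"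
    proof (induction p arbitrary: q)
      case (Pair p1 p2) then show ?case by (cases q; simp; presburger)
    next
      case (Comp p1 p2) then show ?case by (cases q; simp; presburger)
    next
      case (Prec p1 p2) then show ?case by (cases q; simp; presburger)
    next
      case (Mu p) then show ?case by (cases q; simp; presburger)
    qed (case_tac q; simp)+
  qed
  have "\<exists>p. index p = n" for n
  proof (induction n rule: less_induct)
    case (less n)
    show ?case
    proof (cases "n < 5")
      case True
      then have "n = 0 \<or> n = 1 \<or> n = 2 \<or> n = 3 \<or> n = 4" by auto
      then show ?thesis using index.simps(1-5) by metis
    next
      case False
      define k where "k = (n - 5) div 4"
      obtain a b where ab: "prod_decode k = (a, b)" by fastforce
      then have k: "k = prod_encode (a, b)" by (metis prod_decode_inverse)
      have "k < n" using False by (simp add: k_def)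
      moreover have "a \<le> k" "b \<le> k"
        using k le_prod_encode_1 le_prod_encode_2 by auto
      ultimately obtain p q r where "index p = a" "index q = b" "index r = k"
        using less.IH by (meson le_less_trans)
      then have "index (Pair p q) = 5 + 4 * k" "index (Comp p q) = 6 + 4 * k"
        "index (Prec p q) = 7 + 4 * k" "index (Mu r) = 8 + 4 * k"
        using k by simp_all
      moreover have "n = 5 + 4 * k \<or> n = 6 + 4 * k \<or> n = 7 + 4 * k \<or> n = 8 + 4 * k"
        using False unfolding k_def by presburger
      ultimately show ?thesis by metis
    qed
  qed
  then show "surj index" by (metis surjI)
qed

definition turing_le :: "nat set \<Rightarrow> nat set \<Rightarrow> bool" (infix "\<le>\<^sub>T" 50) where
  "X \<le>\<^sub>T Y \<longleftrightarrow> (\<exists>p. \<forall>x. run Y p x = Some (of_bool (x \<in> X)))"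

definition turing_less :: "nat set \<Rightarrow> nat set \<Rightarrow> bool" (infix "<\<^sub>T" 50) where
  "X <\<^sub>T Y \<longleftrightarrow> X \<le>\<^sub>T Y \<and> \<not> Y \<le>\<^sub>T X"

definition jump :: "nat set \<Rightarrow> nat set" where
  "jump X = {index p | p. run X p (index p) \<noteq> None}"


section \<open>Colorings of pairs\<close>

definition two_coloring :: "(nat set \<Rightarrow> nat) \<Rightarrow> bool" where
  "two_coloring C \<longleftrightarrow> C \<in> nsets UNIV 2 \<rightarrow> {0, 1}"

text \<open>A two-element set is coded by the pair of its elements in increasing order.\<close>

definition computable_coloring :: "(nat set \<Rightarrow> nat) \<Rightarrow> bool" where
  "computable_coloring C \<longleftrightarrow>
     (\<exists>p. \<forall>x y. x < y \<longrightarrow> run {} p (prod_encode (x, y)) = Some (C {x, y}))"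

definition almost_homogeneous :: "nat set \<Rightarrow> (nat set \<Rightarrow> nat) \<Rightarrow> bool" where
  "almost_homogeneous A C \<longleftrightarrow> (\<exists>F. finite F \<and> (\<exists>c. \<forall>s \<in> nsets (A - F) 2. C s = c))"

definition two_r_cohesive :: "nat set \<Rightarrow> bool" where
  "two_r_cohesive A \<longleftrightarrow> infinite A \<and>
     (\<forall>C. two_coloring C \<and> computable_coloring C \<longrightarrow> almost_homogeneous A C)"

end

theory Submission
  imports Defs
begin

text \<open>
  By the limit lemma, applied twice, a partial two-valued function \<open>F\<close> computable in \<open>0''\<close> has the form
  \<open>F e = lim\<^sub>s lim\<^sub>t h (e, s, t)\<close> with \<open>h\<close> total and computable. For fixed \<open>e\<close> this is a computable
  coloring of the pairs \<open>s < t\<close>, and a \<open>2\<close>-r-cohesive \<open>A\<close> is almost homogeneous for it; wherever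
  \<open>F e\<close> is defined, the eventual color is \<open>F e\<close>. The eventual color can be found with the oracle
  \<open>A'\<close>, uniformly in \<open>e\<close>, so \<open>A'\<close> computes a total two-valued extension of \<open>F\<close>. Taking for \<open>F\<close> the
  characteristic function of \<open>0''\<close> gives \<open>0'' \<le>\<^sub>T A'\<close>; taking the universal function of \<open>0''\<close> on the
  diagonal, with its nonzero values replaced by \<open>1\<close>, gives a function computable in \<open>A'\<close> but not in \<open>0''\<close>.
\<close>

section \<open>Total computable functions\<close>

abbreviation pi1 :: "nat \<Rightarrow> nat" where "pi1 z \<equiv> fst (prod_decode z)"
abbreviation pi2 :: "nat \<Rightarrow> nat" where "pi2 z \<equiv> snd (prod_decode z)"
abbreviation pair :: "nat \<Rightarrow> nat \<Rightarrow> nat" where "pair a b \<equiv> prod_encode (a, b)"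

definition computable :: "nat set \<Rightarrow> (nat \<Rightarrow> nat) \<Rightarrow> bool" where
  "computable X f \<longleftrightarrow> (\<exists>p. \<forall>x. run X p x = Some (f x))"

abbreviation decidable :: "nat set \<Rightarrow> (nat \<Rightarrow> bool) \<Rightarrow> bool" where
  "decidable X P \<equiv> computable X (\<lambda>x. of_bool (P x))"

lemma turing_le_iff_decidable: "Y \<le>\<^sub>T X \<longleftrightarrow> decidable X (\<lambda>x. x \<in> Y)"
  by (simp add: turing_le_def computable_def)

named_theorems comp_intros

lemma computable_id [comp_intros]: "computable X (\<lambda>x. x)"
  unfolding computable_def by (rule exI[of _ "Pair Fst Snd"]) simp

lemma computable_comp:
  assumes "computable X f" "computable X g"
  shows "computable X (\<lambda>x. f (g x))"
proof -
  obtain p q where "\<forall>x. run X p x = Some (f x)" "\<forall>x. run X q x = Some (g x)"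
    using assms unfolding computable_def by blast
  then show ?thesis unfolding computable_def by (intro exI[of _ "Comp p q"]) simp
qed

lemma computable_pair [comp_intros]:
  assumes "computable X f" "computable X g"
  shows "computable X (\<lambda>x. pair (f x) (g x))"
proof -
  obtain p q where "\<forall>x. run X p x = Some (f x)" "\<forall>x. run X q x = Some (g x)"
    using assms unfolding computable_def by blast
  then show ?thesis unfolding computable_def by (intro exI[of _ "Pair p q"]) simp
qed

text \<open>Programs are unary, so a binary function counts as computable when its uncurried form
  is; this rule passes from that form to a composition with two arguments.\<close>

lemma computable_comp2:
  assumes "computable X (\<lambda>z. f (pi1 z) (pi2 z))" "computable X g" "computable X h"
  shows "computable X (\<lambda>x. f (g x) (h x))"
  using computable_comp[OF assms(1) computable_pair[OF assms(2,3)]] by simp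

lemma computable_Suc [comp_intros]: "computable X f \<Longrightarrow> computable X (\<lambda>x. Suc (f x))"
  by (rule computable_comp[of X Suc]) (auto simp: computable_def intro!: exI[of _ Succ])

lemma computable_pi1 [comp_intros]: "computable X f \<Longrightarrow> computable X (\<lambda>x. pi1 (f x))"
  by (rule computable_comp[of X pi1]) (auto simp: computable_def intro!: exI[of _ Fst])

lemma computable_pi2 [comp_intros]: "computable X f \<Longrightarrow> computable X (\<lambda>x. pi2 (f x))"
  by (rule computable_comp[of X pi2]) (auto simp: computable_def intro!: exI[of _ Snd])

lemma decidable_oracle [comp_intros]:
  "computable X f \<Longrightarrow> decidable X (\<lambda>x. f x \<in> X)"
  by (rule computable_comp[of X "\<lambda>x. of_bool (x \<in> X)"])
    (auto simp: computable_def intro!: exI[of _ Oracle])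

section \<open>Constants, primitive recursion and arithmetic\<close>

primrec const_prog :: "nat \<Rightarrow> prog" where
  "const_prog 0 = Zero"
| "const_prog (Suc n) = Comp Succ (const_prog n)"

lemma run_const_prog [simp]: "run X (const_prog n) x = Some n"
  by (induction n) auto

lemma computable_const [comp_intros]: "computable X (\<lambda>x. c)"
  unfolding computable_def by (rule exI[of _ "const_prog c"]) simp

text \<open>\<open>Prec\<close> with total ingredients never diverges. The arithmetic below reduces
  to this rule by writing each function as a \<open>rec_nat\<close>.\<close>

lemma computable_rec_nat [comp_intros]:
  assumes "computable X f"
    and "computable X (\<lambda>z. g (pi1 z) (pi1 (pi2 z)) (pi2 (pi2 z)))"
    and "computable X h"
  shows "computable X (\<lambda>x. rec_nat (f x) (g x) (h x))"
proof -
  obtain p q where p: "\<And>x. run X p x = Some (f x)"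
    and q: "\<And>z. run X q z = Some (g (pi1 z) (pi1 (pi2 z)) (pi2 (pi2 z)))"
    using assms(1,2) unfolding computable_def by blast
  have rec: "rec_nat (run X p a)
      (\<lambda>k r. Option.bind r (\<lambda>v. run X q (pair a (pair k v)))) n = Some (rec_nat (f a) (g a) n)"
    for a n
    by (induction n) (simp_all add: p q)
  have "computable X (\<lambda>z. rec_nat (f (pi1 z)) (g (pi1 z)) (pi2 z))"
    unfolding computable_def
    by (rule exI[of _ "Prec p q"]) (simp add: split_beta rec)
  from computable_comp2[OF this computable_id assms(3)] show ?thesis .
qed

text \<open>Definition by cases is a recursion whose step ignores both the counter and the previous
  value.\<close>

lemma computable_if_eq_0:
  assumes "computable X n" "computable X f" "computable X g"
  shows "computable X (\<lambda>x. if n x = 0 then f x else g x)"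
proof -
  have "computable X (\<lambda>z. g (pi1 z))"
    by (intro computable_comp[OF assms(3)] comp_intros)
  then have "computable X (\<lambda>x. rec_nat (f x) (\<lambda>_ _. g x) (n x))"
    by (intro comp_intros assms(1,2))
  moreover have "rec_nat a (\<lambda>_ _. b) m = (if m = 0 then a else b)" for a b m :: nat
    by (cases m) auto
  ultimately show ?thesis by simp
qed

lemma computable_If [comp_intros]:
  assumes "decidable X P" "computable X f" "computable X g"
  shows "computable X (\<lambda>x. if P x then f x else g x)"
  using computable_if_eq_0[OF assms(1,3,2)] by (rule back_subst[of "computable X"]) (auto simp: fun_eq_iff)

lemma decidable_not [comp_intros]: "decidable X P \<Longrightarrow> decidable X (\<lambda>x. \<not> P x)"
  using computable_If[OF _ computable_const[of _ 0] computable_const[of _ 1], of X P]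
  by (rule back_subst[of "computable X"]) (auto simp: fun_eq_iff)

lemma decidable_conj [comp_intros]:
  assumes "decidable X P" "decidable X Q"
  shows "decidable X (\<lambda>x. P x \<and> Q x)"
  using computable_If[OF assms computable_const[of _ 0]]
  by (rule back_subst[of "computable X"]) (auto simp: fun_eq_iff)

text \<open>Iterating the predecessor gives truncated subtraction, which in turn gives order and
  equality.\<close>

lemma computable_pred: "computable X f \<Longrightarrow> computable X (\<lambda>x. f x - Suc 0)"
proof -
  assume "computable X f"
  then have "computable X (\<lambda>x. rec_nat 0 (\<lambda>k _. k) (f x))" by (intro comp_intros)
  moreover have "rec_nat 0 (\<lambda>k _. k) n = n - Suc 0" for n by (cases n) auto
  ultimately show ?thesis by simp
qed

lemma computable_diff [comp_intros]:
  assumes "computable X f" "computable X g"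
  shows "computable X (\<lambda>x. f x - g x)"
proof -
  have "computable X (\<lambda>x. rec_nat (f x) (\<lambda>_ r. r - Suc 0) (g x))"
    by (intro comp_intros computable_pred assms)
  moreover have "rec_nat a (\<lambda>_ r. r - Suc 0) b = a - b" for a b :: nat
    by (induction b) auto
  ultimately show ?thesis by simp
qed

lemma decidable_less [comp_intros]:
  assumes "computable X f" "computable X g"
  shows "decidable X (\<lambda>x. f x < g x)"
  using computable_if_eq_0[OF computable_diff[OF assms(2,1)]
      computable_const[of _ 0] computable_const[of _ 1]]
  by (rule back_subst[of "computable X"]) (auto simp: fun_eq_iff)

lemma decidable_le [comp_intros]:
  assumes "computable X f" "computable X g"
  shows "decidable X (\<lambda>x. f x \<le> g x)"
  using decidable_not[OF decidable_less[OF assms(2,1)]] by (simp add: not_less)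

lemma decidable_eq [comp_intros]:
  assumes "computable X f" "computable X g"
  shows "decidable X (\<lambda>x. f x = g x)"
  using decidable_conj[OF decidable_le[OF assms] decidable_le[OF assms(2,1)]]
  by (rule back_subst[of "computable X"]) (auto simp: fun_eq_iff)

lemma computable_add [comp_intros]:
  assumes "computable X f" "computable X g"
  shows "computable X (\<lambda>x. f x + g x)"
proof -
  have "computable X (\<lambda>x. rec_nat (f x) (\<lambda>_ r. Suc r) (g x))"
    by (intro comp_intros assms)
  moreover have "rec_nat a (\<lambda>_ r. Suc r) b = a + b" for a b :: nat
    by (induction b) auto
  ultimately show ?thesis by simp
qed

lemma computable_mult [comp_intros]:
  assumes "computable X f" "computable X g"
  shows "computable X (\<lambda>x. f x * g x)"
proof -
  have "computable X (\<lambda>x. rec_nat 0 (\<lambda>_ r. r + f x) (g x))"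
    by (intro comp_intros computable_comp[OF assms(1)] assms(2))
  moreover have "rec_nat 0 (\<lambda>_ r. r + a) b = a * b" for a b :: nat
    by (induction b) auto
  ultimately show ?thesis by simp
qed

lemma computable_mod [comp_intros]:
  assumes "computable X f" "0 < n"
  shows "computable X (\<lambda>x. f x mod n)"
proof -
  have "computable X (\<lambda>x. rec_nat 0 (\<lambda>_ r. if Suc r = n then 0 else Suc r) (f x))"
    by (intro comp_intros assms)
  moreover have "rec_nat 0 (\<lambda>_ r. if Suc r = n then 0 else Suc r) m = m mod n" for m
    using \<open>0 < n\<close> by (induction m) (auto simp: mod_Suc)
  ultimately show ?thesis by simp
qed

lemma computable_div [comp_intros]:
  assumes "computable X f" "0 < n"
  shows "computable X (\<lambda>x. f x div n)"
proof -
  have "computable X (\<lambda>x. rec_nat 0 (\<lambda>k r. if Suc (k mod n) = n then Suc r else r) (f x))"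
    by (intro comp_intros assms)
  moreover have "rec_nat 0 (\<lambda>k r. if Suc (k mod n) = n then Suc r else r) m = m div n" for m
    using \<open>0 < n\<close> by (induction m) (auto simp: div_Suc mod_Suc)
  ultimately show ?thesis by simp
qed

lemma computable_funpow:
  assumes "computable X f" "computable X g" "computable X n"
  shows "computable X (\<lambda>x. (f ^^ n x) (g x))"
proof -
  have "computable X (\<lambda>x. rec_nat (g x) (\<lambda>_ r. f r) (n x))"
    by (intro comp_intros computable_comp[OF assms(1)] assms(2,3))
  moreover have "rec_nat a (\<lambda>_ r. f r) m = (f ^^ m) a" for a m
    by (induction m) auto
  ultimately show ?thesis by simp
qed

section \<open>Unbounded search and change of oracle\<close>

lemma run_Mu_total:
  assumes "\<And>z. run X p z = Some (f z)"
  shows "run X (Mu p) x =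
    (if \<exists>n. f (pair x n) = 0 then Some (LEAST n. f (pair x n) = 0) else None)"
  by (simp add: assms)

lemma computable_Least:
  assumes "decidable X (\<lambda>z. P (pi1 z) (pi2 z))" and ex: "\<And>x. \<exists>n. P x n"
  shows "computable X (\<lambda>x. LEAST n. P x n)"
proof -
  \<comment> \<open>\<open>Mu\<close> looks for the value 0, so the program searched is the
    characteristic function of the negation.\<close>
  obtain p where "\<And>z. run X p z = Some (of_bool (\<not> P (pi1 z) (pi2 z)))"
    using decidable_not[OF assms(1)] unfolding computable_def by blast
  from run_Mu_total[OF this] show ?thesis
    unfolding computable_def by (intro exI[of _ "Mu p"]) (simp add: ex del: run.simps)
qed

primrec subst_oracle :: "prog \<Rightarrow> prog \<Rightarrow> prog" where
  "subst_oracle r Zero = Zero"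
| "subst_oracle r Succ = Succ"
| "subst_oracle r Fst = Fst"
| "subst_oracle r Snd = Snd"
| "subst_oracle r Oracle = r"
| "subst_oracle r (Pair p q) = Pair (subst_oracle r p) (subst_oracle r q)"
| "subst_oracle r (Comp p q) = Comp (subst_oracle r p) (subst_oracle r q)"
| "subst_oracle r (Prec p q) = Prec (subst_oracle r p) (subst_oracle r q)"
| "subst_oracle r (Mu p) = Mu (subst_oracle r p)"

text \<open>Since \<open>r\<close> answers every query as the oracle \<open>X\<close> would, each
  construct behaves as before, divergence included. This is the transitivity of Turing reducibility
  at the level of programs.\<close>

lemma run_subst_oracle:
  assumes "\<And>x. run Y r x = Some (of_bool (x \<in> X))"
  shows "run Y (subst_oracle r p) = run X p"
proof -
  have "run Y r = run X Oracle" by (simp add: fun_eq_iff assms)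
  then show ?thesis by (induction p) (simp_all cong: if_cong)
qed

lemma computable_turing_le:
  assumes "computable X f" "X \<le>\<^sub>T Y"
  shows "computable Y f"
proof -
  obtain p r where "\<And>x. run X p x = Some (f x)" "\<And>x. run Y r x = Some (of_bool (x \<in> X))"
    using assms unfolding computable_def turing_le_def by blast
  then show ?thesis
    unfolding computable_def by (intro exI[of _ "subst_oracle r p"]) (simp add: run_subst_oracle)
qed


section \<open>A universal machine\<close>

text \<open>
  A state \<open>mstate 0 v K\<close> returns \<open>v\<close> to the stack \<open>K\<close>; a state \<open>mstate (e + 1) v K\<close> runs the program
  with index \<open>e\<close> on \<open>v\<close>. The empty stack is \<open>0\<close>. The tags of frames mean: \<open>0\<close> and \<open>1\<close>, the first and
  second component of \<open>Pair\<close> is being computed; \<open>2\<close>, the inner function of \<open>Comp\<close>; \<open>3\<close>, the recursive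
  call of \<open>Prec\<close>; \<open>4\<close>, a value tested by \<open>Mu\<close>.
\<close>

definition mstate :: "nat \<Rightarrow> nat \<Rightarrow> nat \<Rightarrow> nat" where
  "mstate c v K = pair c (pair v K)"

text \<open>The successor keeps a nonempty stack apart from the empty stack
  \<open>0\<close>.\<close>

definition frame :: "nat \<Rightarrow> nat \<Rightarrow> nat \<Rightarrow> nat" where
  "frame t d K = Suc (pair (pair t d) K)"

text \<open>The data \<open>d\<close> by tag: 0, index of the second program and its input; 1, the
  first value; 2, index of the outer program; 3, index of the step program, parameter and counter;
  4, index of the tested program, input and current candidate.\<close>

definition resume :: "nat \<Rightarrow> nat \<Rightarrow> nat \<Rightarrow> nat \<Rightarrow> nat" where
  "resume t d v K =
    (if t = 0 then mstate (Suc (pi1 d)) (pi2 d) (frame 1 v K)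
     else if t = 1 then mstate 0 (pair d v) K
     else if t = 2 then mstate (Suc d) v K
     else if t = 3 then mstate (Suc (pi1 d)) (pair (pi1 (pi2 d)) (pair (pi2 (pi2 d)) v)) K
     else if v = 0 then mstate 0 (pi2 (pi2 d)) K
     else mstate (Suc (pi1 d)) (pair (pi1 (pi2 d)) (Suc (pi2 (pi2 d))))
       (frame 4 (pair (pi1 d) (pair (pi1 (pi2 d)) (Suc (pi2 (pi2 d))))) K))"

text \<open>Decodes \<open>index\<close>: from 5 on, the residue of \<open>e - 5\<close> modulo 4 is
  the constructor and the quotient codes the subprograms. A \<open>Prec\<close> with positive
  counter calls its own index \<open>e\<close> with the counter lowered.\<close>

definition unfold_prog :: "nat set \<Rightarrow> nat \<Rightarrow> nat \<Rightarrow> nat \<Rightarrow> nat" where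
  "unfold_prog X e v K =
    (if e = 0 then mstate 0 0 K
     else if e = 1 then mstate 0 (Suc v) K
     else if e = 2 then mstate 0 (pi1 v) K
     else if e = 3 then mstate 0 (pi2 v) K
     else if e = 4 then mstate 0 (of_bool (v \<in> X)) K
     else if (e - 5) mod 4 = 0 then
       mstate (Suc (pi1 ((e - 5) div 4))) v (frame 0 (pair (pi2 ((e - 5) div 4)) v) K)
     else if (e - 5) mod 4 = 1 then
       mstate (Suc (pi2 ((e - 5) div 4))) v (frame 2 (pi1 ((e - 5) div 4)) K)
     else if (e - 5) mod 4 = 2 then
       (if pi2 v = 0 then mstate (Suc (pi1 ((e - 5) div 4))) (pi1 v) K
        else mstate (Suc e) (pair (pi1 v) (pi2 v - 1))
          (frame 3 (pair (pi2 ((e - 5) div 4)) (pair (pi1 v) (pi2 v - 1))) K))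
     else mstate (Suc ((e - 5) div 4)) (pair v 0) (frame 4 (pair ((e - 5) div 4) (pair v 0)) K))"

text \<open>Final states, which return to the empty stack, are fixed points, so halting persists at
  later stages.\<close>

definition step :: "nat set \<Rightarrow> nat \<Rightarrow> nat" where
  "step X s =
    (if 0 < pi1 s then unfold_prog X (pi1 s - 1) (pi1 (pi2 s)) (pi2 (pi2 s))
     else if 0 < pi2 (pi2 s) then
       resume (pi1 (pi1 (pi2 (pi2 s) - 1))) (pi2 (pi1 (pi2 (pi2 s) - 1))) (pi1 (pi2 s))
         (pi2 (pi2 (pi2 s) - 1))
     else s)"

lemma computable_step: "computable X (step X)"
  unfolding step_def[abs_def] unfold_prog_def resume_def mstate_def frame_def
  by (intro comp_intros) simp_all

lemma step_simps [simp]: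
  "step X (mstate (Suc e) v K) = unfold_prog X e v K"
  "step X (mstate 0 v (frame t d K)) = resume t d v K"
  "step X (mstate 0 v 0) = mstate 0 v 0"
  by (simp_all add: step_def mstate_def frame_def)

lemma unfold_prog_simps [simp]:
  "unfold_prog X (index Zero) v K = mstate 0 0 K"
  "unfold_prog X (index Succ) v K = mstate 0 (Suc v) K"
  "unfold_prog X (index Fst) v K = mstate 0 (pi1 v) K"
  "unfold_prog X (index Snd) v K = mstate 0 (pi2 v) K"
  "unfold_prog X (index Oracle) v K = mstate 0 (of_bool (v \<in> X)) K"
  "unfold_prog X (index (Pair p q)) v K = mstate (Suc (index p)) v (frame 0 (pair (index q) v) K)"
  "unfold_prog X (index (Comp p q)) v K = mstate (Suc (index q)) v (frame 2 (index p) K)"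
  "unfold_prog X (index (Prec p q)) (pair a 0) K = mstate (Suc (index p)) a K"
  "unfold_prog X (index (Prec p q)) (pair a (Suc n)) K =
     mstate (Suc (index (Prec p q))) (pair a n) (frame 3 (pair (index q) (pair a n)) K)"
  "unfold_prog X (index (Mu p)) v K =
     mstate (Suc (index p)) (pair v 0) (frame 4 (pair (index p) (pair v 0)) K)"
proof -
  \<comment> \<open>The forms that \<open>e - 5\<close> takes for \<open>Comp\<close>,
    \<open>Prec\<close> and \<open>Mu\<close>.\<close>
  have "Suc (4 * k) div 4 = k" "Suc (4 * k) mod 4 = 1"
    "Suc (Suc (4 * k)) div 4 = k" "Suc (Suc (4 * k)) mod 4 = 2"
    "Suc (Suc (Suc (4 * k))) div 4 = k" "Suc (Suc (Suc (4 * k))) mod 4 = 3" for k :: nat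
    by presburger+
  then show
    "unfold_prog X (index Zero) v K = mstate 0 0 K"
    "unfold_prog X (index Succ) v K = mstate 0 (Suc v) K"
    "unfold_prog X (index Fst) v K = mstate 0 (pi1 v) K"
    "unfold_prog X (index Snd) v K = mstate 0 (pi2 v) K"
    "unfold_prog X (index Oracle) v K = mstate 0 (of_bool (v \<in> X)) K"
    "unfold_prog X (index (Pair p q)) v K = mstate (Suc (index p)) v (frame 0 (pair (index q) v) K)"
    "unfold_prog X (index (Comp p q)) v K = mstate (Suc (index q)) v (frame 2 (index p) K)"
    "unfold_prog X (index (Prec p q)) (pair a 0) K = mstate (Suc (index p)) a K"
    "unfold_prog X (index (Prec p q)) (pair a (Suc n)) K =
       mstate (Suc (index (Prec p q))) (pair a n) (frame 3 (pair (index q) (pair a n)) K)"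
    "unfold_prog X (index (Mu p)) v K =
       mstate (Suc (index p)) (pair v 0) (frame 4 (pair (index p) (pair v 0)) K)"
    by (simp_all add: unfold_prog_def)
qed

lemma resume_simps [simp]:
  "resume 0 (pair e x) v K = mstate (Suc e) x (frame 1 v K)"
  "resume 1 d v K = mstate 0 (pair d v) K"
  "resume (Suc 0) d v K = mstate 0 (pair d v) K"
  "resume 2 d v K = mstate (Suc d) v K"
  "resume 3 (pair e (pair a n)) v K = mstate (Suc e) (pair a (pair n v)) K"
  "resume 4 (pair e (pair x n)) 0 K = mstate 0 n K"
  "0 < v \<Longrightarrow> resume 4 (pair e (pair x n)) v K =
     mstate (Suc e) (pair x (Suc n)) (frame 4 (pair e (pair x (Suc n))) K)"
  by (simp_all add: resume_def)

section \<open>Correctness of the simulation\<close>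

definition halts_in :: "nat set \<Rightarrow> nat \<Rightarrow> nat \<Rightarrow> bool" where
  "halts_in X n s \<longleftrightarrow> (\<exists>y. (step X ^^ n) s = mstate 0 y 0)"

lemma halts_in_mono:
  assumes "(step X ^^ m) s = mstate 0 y 0" "m \<le> n"
  shows "(step X ^^ n) s = mstate 0 y 0"
  using assms(2) by (induction rule: dec_induct) (simp_all add: assms(1))

text \<open>A state that runs a program is not final, so at least one step is made from it. The
  strict drop of the step count drives the induction for \<open>Mu\<close>.\<close>

lemma halts_in_unfold:
  assumes "halts_in X n (mstate (Suc e) v K)"
  obtains m where "m < n" "halts_in X m (unfold_prog X e v K)"
proof (cases n)
  case 0
  then show ?thesis using assms by (simp add: halts_in_def mstate_def)
next
  case (Suc m)
  then have "halts_in X m (unfold_prog X e v K)"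
    using assms by (simp add: halts_in_def funpow_Suc_right del: funpow.simps)
  then show ?thesis using that[of m] Suc by simp
qed

lemma halts_in_resume:
  assumes "halts_in X n (mstate 0 v (frame t d K))"
  obtains m where "m < n" "halts_in X m (resume t d v K)"
proof (cases n)
  case 0
  then show ?thesis using assms by (simp add: halts_in_def mstate_def frame_def)
next
  case (Suc m)
  then have "halts_in X m (resume t d v K)"
    using assms by (simp add: halts_in_def funpow_Suc_right del: funpow.simps)
  then show ?thesis using that[of m] Suc by simp
qed

inductive reaches :: "nat set \<Rightarrow> nat \<Rightarrow> nat \<Rightarrow> bool" for X where
  refl: "reaches X s s"
| step: "reaches X (step X s) t \<Longrightarrow> reaches X s t"

lemma reaches_trans: "reaches X s t \<Longrightarrow> reaches X t u \<Longrightarrow> reaches X s u"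
  by (induction rule: reaches.induct) (auto intro: reaches.intros)

lemma reaches_funpow: "reaches X s t \<Longrightarrow> \<exists>n. (step X ^^ n) s = t"
proof (induction rule: reaches.induct)
  case (refl s)
  show ?case by (rule exI[of _ 0]) simp
next
  case (step s t)
  then obtain n where "(step X ^^ n) (step X s) = t" by blast
  then show ?case
    by (intro exI[of _ "Suc n"]) (simp add: funpow_Suc_right del: funpow.simps)
qed

text \<open>Downward induction on the candidate: at \<open>n\<close> the value 0 makes the frame
  return \<open>n\<close>, and below \<open>n\<close> a positive value moves the search to the next
  candidate.\<close>

lemma reaches_Mu:
  assumes p: "\<And>x v K. run X p x = Some v \<Longrightarrow> reaches X (mstate (Suc (index p)) x K) (mstate 0 v K)"
    and n: "run X p (pair x n) = Some 0"
    and m: "\<And>m. m < n \<Longrightarrow> \<exists>v. run X p (pair x m) = Some v \<and> 0 < v"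
    and "m \<le> n"
  shows "reaches X (mstate (Suc (index p)) (pair x m) (frame 4 (pair (index p) (pair x m)) K))
    (mstate 0 n K)"
  using \<open>m \<le> n\<close>
proof (induction rule: inc_induct)
  case base
  have "reaches X (mstate 0 0 (frame 4 (pair (index p) (pair x n)) K)) (mstate 0 n K)"
    by (rule reaches.step) (simp add: reaches.refl)
  then show ?case using p[OF n] reaches_trans by blast
next
  case (step j)
  obtain v where v: "run X p (pair x j) = Some v" "0 < v" using m[OF step(2)] by blast
  have "reaches X (mstate 0 v (frame 4 (pair (index p) (pair x j)) K)) (mstate 0 n K)"
    by (rule reaches.step) (simp add: v(2) step(3))
  then show ?case using p[OF v(1)] reaches_trans by blast
qed

text \<open>Completeness of the machine. The stack \<open>K\<close> is arbitrary because subprograms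
  run on top of the frames of their callers.\<close>

lemma reaches_run:
  "run X p x = Some v \<Longrightarrow> reaches X (mstate (Suc (index p)) x K) (mstate 0 v K)"
proof (induction p arbitrary: x v K)
  case (Pair p q)
  then obtain a b where ab: "run X p x = Some a" "run X q x = Some b" "v = pair a b"
    by (auto simp: bind_eq_Some_conv)
  have "reaches X (mstate (Suc (index q)) x (frame 1 a K)) (mstate 0 v K)"
    by (rule reaches_trans[OF Pair.IH(2)[OF ab(2)]], rule reaches.step)
      (simp add: ab(3) reaches.refl)
  then have "reaches X (mstate (Suc (index p)) x (frame 0 (pair (index q) x) K)) (mstate 0 v K)"
    by - (rule reaches_trans[OF Pair.IH(1)[OF ab(1)]], rule reaches.step, simp)
  then show ?case by - (rule reaches.step, simp del: index.simps)
next
  case (Comp p q)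
  then obtain a where a: "run X q x = Some a" "run X p a = Some v"
    by (auto simp: bind_eq_Some_conv)
  have "reaches X (mstate (Suc (index q)) x (frame 2 (index p) K)) (mstate 0 v K)"
    by (rule reaches_trans[OF Comp.IH(2)[OF a(1)]], rule reaches.step)
      (simp add: Comp.IH(1)[OF a(2)])
  then show ?case by - (rule reaches.step, simp del: index.simps)
next
  case (Prec p q)
  obtain a n where x: "x = pair a n" by (metis prod_decode_inverse surj_pair)
  \<comment> \<open>\<open>Prec\<close> calls itself, so the structural induction is supplemented by
    one on the counter.\<close>
  have "reaches X (mstate (Suc (index (Prec p q))) (pair a n) K) (mstate 0 v K)"
    using Prec.prems unfolding x
  proof (induction n arbitrary: v K)
    case 0
    then have "run X p a = Some v" by simp
    then show ?case by - (rule reaches.step, simp add: Prec.IH(1) del: index.simps)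
  next
    case (Suc n)
    then obtain u where u: "run X (Prec p q) (pair a n) = Some u"
      "run X q (pair a (pair n u)) = Some v"
      by (auto simp: bind_eq_Some_conv)
    have "reaches X (mstate (Suc (index (Prec p q))) (pair a n)
        (frame 3 (pair (index q) (pair a n)) K)) (mstate 0 v K)"
      by (rule reaches_trans[OF Suc.IH[OF u(1)]], rule reaches.step)
        (simp add: Prec.IH(2)[OF u(2)])
    then show ?case by - (rule reaches.step, simp del: index.simps)
  qed
  then show ?case by (simp add: x)
next
  case (Mu p)
  obtain n where n: "run X p (pair x n) = Some 0" "\<forall>m<n. run X p (pair x m) \<noteq> None"
    using Mu.prems by (auto split: if_splits)
  \<comment> \<open>The least zero \<open>l\<close> is at most \<open>n\<close>, so all values below
    it converge, and by minimality they are positive.\<close>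
  define l where "l = (LEAST n. run X p (pair x n) = Some 0)"
  have v: "v = l" using Mu.prems by (auto simp: l_def split: if_splits)
  have l: "run X p (pair x l) = Some 0" "l \<le> n"
    unfolding l_def using n(1) by (rule LeastI, rule Least_le)
  have "\<exists>v. run X p (pair x m) = Some v \<and> 0 < v" if "m < l" for m
  proof -
    from n(2) that l(2) obtain v where v: "run X p (pair x m) = Some v" by fastforce
    then show ?thesis using not_less_Least[OF that[unfolded l_def]] by (cases v) auto
  qed
  from reaches_Mu[OF Mu.IH l(1) this, of 0]
  show ?case by - (rule reaches.step, simp add: v del: index.simps)
qed (rule reaches.step, simp add: reaches.refl del: index.simps)+

text \<open>The number of candidates tried is not known in advance, so the induction is on the
  number of steps until halting.\<close>

lemma halts_in_Mu:
  assumes p: "\<And>n x K. halts_in X n (mstate (Suc (index p)) x K) \<Longrightarrow>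
      \<exists>v m. m < n \<and> run X p x = Some v \<and> halts_in X m (mstate 0 v K)"
    and "halts_in X n (mstate (Suc (index p)) (pair x j) (frame 4 (pair (index p) (pair x j)) K))"
  shows "\<exists>k\<ge>j. \<exists>m<n. run X p (pair x k) = Some 0 \<and>
    (\<forall>i. j \<le> i \<and> i < k \<longrightarrow> (\<exists>v. run X p (pair x i) = Some v \<and> 0 < v)) \<and>
    halts_in X m (mstate 0 k K)"
  using assms(2)
proof (induction n arbitrary: j rule: less_induct)
  case (less n)
  obtain v m where v: "m < n" "run X p (pair x j) = Some v"
    "halts_in X m (mstate 0 v (frame 4 (pair (index p) (pair x j)) K))"
    using p[OF less.prems] by blast
  obtain i where i: "i < m" "halts_in X i (resume 4 (pair (index p) (pair x j)) v K)"
    using halts_in_resume[OF v(3)] .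
  show ?case
  proof (cases "v = 0")
    case True
    then show ?thesis using v i by (intro exI[of _ j] conjI exI[of _ i]) auto
  next
    case False
    then have "halts_in X i
        (mstate (Suc (index p)) (pair x (Suc j)) (frame 4 (pair (index p) (pair x (Suc j))) K))"
      using i(2) by simp
    from less.IH[OF _ this] v(1) i(1) obtain k l where k: "Suc j \<le> k" "l < i"
      "run X p (pair x k) = Some 0"
      "\<forall>i. Suc j \<le> i \<and> i < k \<longrightarrow> (\<exists>v. run X p (pair x i) = Some v \<and> 0 < v)"
      "halts_in X l (mstate 0 k K)"
      by (meson less_trans)
    have "\<exists>v. run X p (pair x i) = Some v \<and> 0 < v" if "j \<le> i" "i < k" for i
      using that k(4) v(2) False by (cases "i = j") auto
    then show ?thesis using k v(1) i(1)
      by (intro exI[of _ k] conjI exI[of _ l]) auto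
  qed
qed

text \<open>Soundness of the machine: frames of \<open>K\<close> are touched only after a value is
  returned to \<open>K\<close>, so a halting computation must pass through such a return. The
  remaining count \<open>m\<close> lets the next subprogram be treated in the same way.\<close>

lemma run_of_halts_in:
  "halts_in X n (mstate (Suc (index p)) x K) \<Longrightarrow>
    \<exists>v m. m < n \<and> run X p x = Some v \<and> halts_in X m (mstate 0 v K)"
proof (induction p arbitrary: n x K)
  case (Pair p q)
  obtain n1 where n1: "n1 < n"
    "halts_in X n1 (mstate (Suc (index p)) x (frame 0 (pair (index q) x) K))"
    using halts_in_unfold[OF Pair.prems] by (metis unfold_prog_simps(6))
  obtain a n2 where n2: "n2 < n1" "run X p x = Some a"
    "halts_in X n2 (mstate 0 a (frame 0 (pair (index q) x) K))"
    using Pair.IH(1)[OF n1(2)] by blast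
  obtain n3 where n3: "n3 < n2" "halts_in X n3 (mstate (Suc (index q)) x (frame 1 a K))"
    using halts_in_resume[OF n2(3)] by (metis resume_simps(1))
  obtain b n4 where n4: "n4 < n3" "run X q x = Some b" "halts_in X n4 (mstate 0 b (frame 1 a K))"
    using Pair.IH(2)[OF n3(2)] by blast
  obtain n5 where n5: "n5 < n4" "halts_in X n5 (mstate 0 (pair a b) K)"
    using halts_in_resume[OF n4(3)] by (metis resume_simps(2))
  show ?case
    using n1(1) n2(1,2) n3(1) n4(1,2) n5 by (intro exI[of _ "pair a b"] exI[of _ n5]) auto
next
  case (Comp p q)
  obtain n1 where n1: "n1 < n" "halts_in X n1 (mstate (Suc (index q)) x (frame 2 (index p) K))"
    using halts_in_unfold[OF Comp.prems] by (metis unfold_prog_simps(7))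
  obtain a n2 where n2: "n2 < n1" "run X q x = Some a"
    "halts_in X n2 (mstate 0 a (frame 2 (index p) K))"
    using Comp.IH(2)[OF n1(2)] by blast
  obtain n3 where n3: "n3 < n2" "halts_in X n3 (mstate (Suc (index p)) a K)"
    using halts_in_resume[OF n2(3)] by (metis resume_simps(4))
  obtain b n4 where n4: "n4 < n3" "run X p a = Some b" "halts_in X n4 (mstate 0 b K)"
    using Comp.IH(1)[OF n3(2)] by blast
  show ?case
    using n1(1) n2(1,2) n3(1) n4 by (intro exI[of _ b] exI[of _ n4]) auto
next
  case (Prec p q)
  obtain a k where x: "x = pair a k" by (metis prod_decode_inverse surj_pair)
  have "\<exists>v m. m < n \<and> run X (Prec p q) (pair a k) = Some v \<and> halts_in X m (mstate 0 v K)"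
    using Prec.prems unfolding x
  proof (induction k arbitrary: n K)
    case 0
    obtain n1 where n1: "n1 < n" "halts_in X n1 (mstate (Suc (index p)) a K)"
      using halts_in_unfold[OF 0] by (metis unfold_prog_simps(8))
    obtain v n2 where n2: "n2 < n1" "run X p a = Some v" "halts_in X n2 (mstate 0 v K)"
      using Prec.IH(1)[OF n1(2)] by blast
    show ?case using n1(1) n2 by (intro exI[of _ v] exI[of _ n2]) auto
  next
    case (Suc k)
    obtain n1 where n1: "n1 < n" "halts_in X n1
        (mstate (Suc (index (Prec p q))) (pair a k) (frame 3 (pair (index q) (pair a k)) K))"
      using halts_in_unfold[OF Suc.prems] by (metis unfold_prog_simps(9))
    obtain v n2 where n2: "n2 < n1" "run X (Prec p q) (pair a k) = Some v"
      "halts_in X n2 (mstate 0 v (frame 3 (pair (index q) (pair a k)) K))"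
      using Suc.IH[OF n1(2)] by blast
    obtain n3 where n3: "n3 < n2" "halts_in X n3 (mstate (Suc (index q)) (pair a (pair k v)) K)"
      using halts_in_resume[OF n2(3)] by (metis resume_simps(5))
    obtain w n4 where n4: "n4 < n3" "run X q (pair a (pair k v)) = Some w"
      "halts_in X n4 (mstate 0 w K)"
      using Prec.IH(2)[OF n3(2)] by blast
    show ?case using n1(1) n2(1,2) n3(1) n4 by (intro exI[of _ w] exI[of _ n4]) auto
  qed
  then show ?case by (simp add: x)
next
  case (Mu p)
  obtain n1 where n1: "n1 < n" "halts_in X n1
      (mstate (Suc (index p)) (pair x 0) (frame 4 (pair (index p) (pair x 0)) K))"
    using halts_in_unfold[OF Mu.prems] by (metis unfold_prog_simps(10))
  obtain k m where k: "m < n1" "run X p (pair x k) = Some 0"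
    "\<And>i. i < k \<Longrightarrow> \<exists>v. run X p (pair x i) = Some v \<and> 0 < v" "halts_in X m (mstate 0 k K)"
    using halts_in_Mu[OF Mu.IH n1(2)] by auto
  have "(LEAST n. run X p (pair x n) = Some 0) = k"
    using k(2,3) by (intro Least_equality) (fastforce simp: not_less[symmetric])+
  moreover have "\<forall>i<k. run X p (pair x i) \<noteq> None" using k(3) by fastforce
  ultimately have "run X (Mu p) x = Some k" using k(2) by auto
  then show ?case using k(1,4) n1(1) by (intro exI[of _ k] exI[of _ m]) simp
next
  case Zero
  show ?case using halts_in_unfold[OF Zero] by (metis unfold_prog_simps(1) run.simps(1))
next
  case Succ
  show ?case using halts_in_unfold[OF Succ] by (metis unfold_prog_simps(2) run.simps(2))
next
  case Fst
  show ?case using halts_in_unfold[OF Fst] by (metis unfold_prog_simps(3) run.simps(3))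
next
  case Snd
  show ?case using halts_in_unfold[OF Snd] by (metis unfold_prog_simps(4) run.simps(4))
next
  case Oracle
  show ?case using halts_in_unfold[OF Oracle] by (metis unfold_prog_simps(5) run.simps(5))
qed

section \<open>Programs run on their own index\<close>

definition diag_state :: "nat set \<Rightarrow> nat \<Rightarrow> nat \<Rightarrow> nat" where
  "diag_state X e s = (step X ^^ s) (mstate (Suc e) e 0)"

definition halted :: "nat \<Rightarrow> bool" where
  "halted s \<longleftrightarrow> pi1 s = 0 \<and> pi2 (pi2 s) = 0"

lemma halted_iff: "halted s \<longleftrightarrow> (\<exists>y. s = mstate 0 y 0)"
  unfolding halted_def mstate_def
  by (metis prod_decode_inverse prod_encode_inverse fst_conv snd_conv surjective_pairing)

lemma computable_diag_state:
  "computable X (\<lambda>z. diag_state X (pi1 z) (pi2 z))"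
  unfolding diag_state_def mstate_def by (intro computable_funpow computable_step comp_intros)

lemma decidable_halted: "decidable X halted"
  unfolding halted_def[abs_def] by (intro comp_intros)

lemma diag_state_mono:
  assumes "diag_state X e m = mstate 0 y 0" "m \<le> n"
  shows "diag_state X e n = mstate 0 y 0"
  using halts_in_mono assms unfolding diag_state_def by blast

lemma diag_state_run:
  assumes "run X p (index p) = Some v"
  shows "\<exists>n. diag_state X (index p) n = mstate 0 v 0"
  using reaches_funpow[OF reaches_run[OF assms]] by (simp add: diag_state_def)

text \<open>Completeness gives one direction and soundness the other; every \<open>e\<close> is an
  index because \<open>index\<close> is onto.\<close>

lemma halted_diag_state:
  "(\<exists>n. halted (diag_state X e n)) \<longleftrightarrow> e \<in> jump X"
proof -
  obtain p where e: "e = index p" using bij_index by (meson bij_pointE)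
  have "e \<in> jump X \<longleftrightarrow> run X p (index p) \<noteq> None"
    unfolding e jump_def using bij_index by (auto simp: bij_def inj_eq)
  also have "\<dots> \<longleftrightarrow> (\<exists>n. halted (diag_state X e n))"
  proof
    assume "run X p (index p) \<noteq> None"
    then show "\<exists>n. halted (diag_state X e n)"
      using diag_state_run halted_iff e by (metis not_None_eq)
  next
    assume "\<exists>n. halted (diag_state X e n)"
    then obtain n where "halts_in X n (mstate (Suc (index p)) (index p) 0)"
      by (auto simp: halted_iff halts_in_def diag_state_def e)
    then show "run X p (index p) \<noteq> None" using run_of_halts_in by fastforce
  qed
  finally show ?thesis by simp
qed

text \<open>The program \<open>u\<close> searches for the first stage at which program
  \<open>e\<close> has halted on input \<open>e\<close>, then reads the value off that state;
  \<open>Pair Fst Snd\<close> carries \<open>e\<close> along.\<close>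

lemma universal_diagonal:
  obtains u where "\<And>p v. run X p (index p) = Some v \<Longrightarrow> run X u (index p) = Some v"
proof -
  obtain r where r: "\<And>z. run X r z = Some (of_bool (\<not> halted (diag_state X (pi1 z) (pi2 z))))"
    using decidable_not[OF computable_comp[OF decidable_halted computable_diag_state]]
    unfolding computable_def by blast
  have "computable X (\<lambda>z. pi1 (pi2 (diag_state X (pi1 z) (pi2 z))))"
    by (intro comp_intros computable_diag_state)
  then obtain d where d: "\<And>z. run X d z = Some (pi1 (pi2 (diag_state X (pi1 z) (pi2 z))))"
    unfolding computable_def by blast
  define u where "u = Comp d (Pair (Pair Fst Snd) (Mu r))"
  have "run X u (index p) = Some v" if v: "run X p (index p) = Some v" for p v
  proof -
    obtain n where n: "diag_state X (index p) n = mstate 0 v 0" using diag_state_run[OF v] by blast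
    define l where "l = (LEAST n. halted (diag_state X (index p) n))"
    have ex: "\<exists>n. halted (diag_state X (index p) n)" using n halted_iff by metis
    then have "halted (diag_state X (index p) l)" unfolding l_def by (rule LeastI_ex)
    then obtain y where y: "diag_state X (index p) l = mstate 0 y 0" using halted_iff by blast
    \<comment> \<open>Final states persist, so both values can be compared at the later of the two
      stages.\<close>
    have "y = v"
      using diag_state_mono[OF n, of "max n l"] diag_state_mono[OF y, of "max n l"]
      by (simp add: mstate_def)
    moreover have "run X (Mu r) (index p) = Some l"
      using ex by (subst run_Mu_total[OF r]) (simp add: l_def)
    ultimately show ?thesis by (simp add: u_def d y mstate_def del: run.simps(9))
  qed
  then show thesis using that by blast
qed


section \<open>The limit lemma\<close>

text \<open>
  Limits commute with every program construct, so the limit lemma goes by induction on the program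
  and needs a stage-by-stage approximation only to the jump itself.
\<close>

definition bounded_least :: "(nat \<Rightarrow> nat) \<Rightarrow> nat \<Rightarrow> nat" where
  "bounded_least g s = rec_nat 0 (\<lambda>k r. if r = 0 \<and> g k = 0 then Suc k else r) s - 1"

lemma bounded_least_eq:
  assumes "g n = 0" "\<And>m. m < n \<Longrightarrow> 0 < g m" "n < s"
  shows "bounded_least g s = n"
proof -
  let ?r = "rec_nat 0 (\<lambda>k r. if r = 0 \<and> g k = 0 then Suc k else r)"
  have "j \<le> n \<Longrightarrow> ?r j = 0" for j
    using assms(2) by (induction j) auto
  then have found: "?r (Suc n) = Suc n" using assms(1) by simp
  have "Suc n \<le> s" using assms(3) by simp
  then have "?r s = Suc n"
    by (induction rule: dec_induct) (rule found, simp)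
  then show ?thesis by (simp add: bounded_least_def)
qed

text \<open>The approximation \<open>f\<close> is total, while its limit is controlled only where
  \<open>p\<close> converges; this covers partial functions.\<close>

lemma limit_lemma:
  "\<exists>f. computable X (\<lambda>z. f (pi1 z) (pi2 z)) \<and>
    (\<forall>x v. run (jump X) p x = Some v \<longrightarrow> (\<forall>\<^sub>F s in sequentially. f x s = v))"
proof (induction p)
  case Zero
  show ?case by (rule exI[of _ "\<lambda>x s. 0"]) (auto intro: comp_intros)
next
  case Succ
  show ?case by (rule exI[of _ "\<lambda>x s. Suc x"]) (auto intro!: comp_intros)
next
  case Fst
  show ?case by (rule exI[of _ "\<lambda>x s. pi1 x"]) (auto intro!: comp_intros)
next
  case Snd
  show ?case by (rule exI[of _ "\<lambda>x s. pi2 x"]) (auto intro!: comp_intros)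
next
  case Oracle
  \<comment> \<open>Halting by stage \<open>s\<close> is monotone in \<open>s\<close>: for members
    of the jump it becomes true and stays so, for others it is never true.\<close>
  have lim: "\<forall>\<^sub>F s in sequentially. halted (diag_state X x s) \<longleftrightarrow> x \<in> jump X" for x
  proof (cases "x \<in> jump X")
    case True
    then obtain n y where "diag_state X x n = mstate 0 y 0"
      using halted_diag_state halted_iff by metis
    then have "\<forall>s\<ge>n. halted (diag_state X x s)"
      using diag_state_mono halted_iff by blast
    then show ?thesis using True by (auto simp: eventually_sequentially)
  next
    case False
    then show ?thesis using halted_diag_state by (auto intro!: always_eventually)
  qed
  have "\<forall>\<^sub>F s in sequentially. of_bool (halted (diag_state X x s)) = (of_bool (x \<in> jump X) :: nat)"
    for x
    by (rule eventually_mono[OF lim[of x]]) simp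
  moreover have "computable X (\<lambda>z. of_bool (halted (diag_state X (pi1 z) (pi2 z))))"
    by (rule computable_comp[OF decidable_halted computable_diag_state])
  ultimately show ?case
    by (intro exI[of _ "\<lambda>x s. of_bool (halted (diag_state X x s))"]) auto
next
  case (Pair p q)
  then obtain f g where f: "computable X (\<lambda>z. f (pi1 z) (pi2 z))"
      "\<And>x v. run (jump X) p x = Some v \<Longrightarrow> \<forall>\<^sub>F s in sequentially. f x s = v"
    and g: "computable X (\<lambda>z. g (pi1 z) (pi2 z))"
      "\<And>x v. run (jump X) q x = Some v \<Longrightarrow> \<forall>\<^sub>F s in sequentially. g x s = v"
    by blast
  have "\<forall>\<^sub>F s in sequentially. pair (f x s) (g x s) = v"
    if "run (jump X) (Pair p q) x = Some v" for x v
  proof -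
    from that obtain a b where ab: "run (jump X) p x = Some a" "run (jump X) q x = Some b" "v = pair a b"
      by (auto simp: bind_eq_Some_conv)
    from f(2)[OF ab(1)] g(2)[OF ab(2)] show ?thesis
      by eventually_elim (simp add: ab(3))
  qed
  then show ?case using computable_pair[OF f(1) g(1)]
    by (intro exI[of _ "\<lambda>x s. pair (f x s) (g x s)"]) blast
next
  case (Comp p q)
  then obtain f g where f: "computable X (\<lambda>z. f (pi1 z) (pi2 z))"
      "\<And>x v. run (jump X) p x = Some v \<Longrightarrow> \<forall>\<^sub>F s in sequentially. f x s = v"
    and g: "computable X (\<lambda>z. g (pi1 z) (pi2 z))"
      "\<And>x v. run (jump X) q x = Some v \<Longrightarrow> \<forall>\<^sub>F s in sequentially. g x s = v"
    by blast
  have "\<forall>\<^sub>F s in sequentially. f (g x s) s = v"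
    if "run (jump X) (Comp p q) x = Some v" for x v
  proof -
    from that obtain a where a: "run (jump X) q x = Some a" "run (jump X) p a = Some v"
      by (auto simp: bind_eq_Some_conv)
    from g(2)[OF a(1)] f(2)[OF a(2)] show ?thesis
      by eventually_elim simp
  qed
  moreover have "computable X (\<lambda>z. f (g (pi1 z) (pi2 z)) (pi2 z))"
    by (intro computable_comp2[OF f(1)] g(1) comp_intros)
  ultimately show ?case by (intro exI[of _ "\<lambda>x s. f (g x s) s"]) blast
next
  case (Prec p q)
  then obtain f g where f: "computable X (\<lambda>z. f (pi1 z) (pi2 z))"
      "\<And>x v. run (jump X) p x = Some v \<Longrightarrow> \<forall>\<^sub>F s in sequentially. f x s = v"
    and g: "computable X (\<lambda>z. g (pi1 z) (pi2 z))"
      "\<And>x v. run (jump X) q x = Some v \<Longrightarrow> \<forall>\<^sub>F s in sequentially. g x s = v"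
    by blast
  \<comment> \<open>The whole recursion is run at one stage \<open>s\<close>; its value at
    \<open>n\<close> depends on finitely many values, all of which stabilize.\<close>
  define h where "h a s = rec_nat (f a s) (\<lambda>k r. g (pair a (pair k r)) s)" for a s
  have "run (jump X) (Prec p q) (pair a n) = Some v \<Longrightarrow> \<forall>\<^sub>F s in sequentially. h a s n = v"
    for a n v
  proof (induction n arbitrary: v)
    case 0
    then show ?case using f(2) by (simp add: h_def)
  next
    case (Suc n)
    then obtain u where u: "run (jump X) (Prec p q) (pair a n) = Some u"
      "run (jump X) q (pair a (pair n u)) = Some v"
      by (auto simp: bind_eq_Some_conv)
    from Suc.IH[OF u(1)] g(2)[OF u(2)] show ?case
      by eventually_elim (simp add: h_def)
  qed
  then have "\<forall>\<^sub>F s in sequentially. h (pi1 x) s (pi2 x) = v"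
    if "run (jump X) (Prec p q) x = Some v" for x v
    using that by (metis prod_decode_inverse surjective_pairing)
  moreover have "computable X (\<lambda>z. h (pi1 (pi1 z)) (pi2 z) (pi2 (pi1 z)))"
    unfolding h_def by (intro comp_intros computable_comp2[OF f(1)] computable_comp2[OF g(1)])
  ultimately show ?case by (intro exI[of _ "\<lambda>x s. h (pi1 x) s (pi2 x)"]) blast
next
  case (Mu p)
  then obtain f where f: "computable X (\<lambda>z. f (pi1 z) (pi2 z))"
      "\<And>x v. run (jump X) p x = Some v \<Longrightarrow> \<forall>\<^sub>F s in sequentially. f x s = v"
    by blast
  have "\<forall>\<^sub>F s in sequentially. bounded_least (\<lambda>n. f (pair x n) s) s = v"
    if run: "run (jump X) (Mu p) x = Some v" for x v
  proof -
    obtain n where n: "run (jump X) p (pair x n) = Some 0" "\<forall>m<n. run (jump X) p (pair x m) \<noteq> None"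
      using run by (auto split: if_splits)
    have v: "v = (LEAST n. run (jump X) p (pair x n) = Some 0)"
      using run by (auto split: if_splits)
    have v0: "run (jump X) p (pair x v) = Some 0" "v \<le> n"
      unfolding v using n(1) by (rule LeastI, rule Least_le)
    \<comment> \<open>Only finitely many candidates precede \<open>v\<close>, so from some stage on
      all their values are positive at once; a stage beyond \<open>v\<close> also lets the bounded
      search reach \<open>v\<close>.\<close>
    have "\<forall>\<^sub>F s in sequentially. \<forall>m\<in>{..<v}. 0 < f (pair x m) s"
    proof (intro eventually_ball_finite ballI)
      fix m assume m: "m \<in> {..<v}"
      then obtain w where w: "run (jump X) p (pair x m) = Some w" using n(2) v0(2) by fastforce
      moreover have "run (jump X) p (pair x m) \<noteq> Some 0"
        using m not_less_Least unfolding v by blast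
      ultimately have "0 < w" by auto
      with f(2)[OF w] show "\<forall>\<^sub>F s in sequentially. 0 < f (pair x m) s"
        by (auto elim: eventually_mono)
    qed simp
    with f(2)[OF v0(1)] eventually_gt_at_top[of v] show ?thesis
      by eventually_elim (auto intro: bounded_least_eq)
  qed
  moreover have "computable X (\<lambda>z. bounded_least (\<lambda>n. f (pair (pi1 z) n) (pi2 z)) (pi2 z))"
    unfolding bounded_least_def by (intro comp_intros computable_comp2[OF f(1)])
  ultimately show ?case
    by (intro exI[of _ "\<lambda>x s. bounded_least (\<lambda>n. f (pair x n) s) s"]) blast
qed

text \<open>The limit lemma over \<open>jump X\<close> turns \<open>p\<close> into a total
  \<open>f\<close>, and over \<open>X\<close> it approximates a program for \<open>f\<close>. As
  \<open>f\<close> is total, the inner limit exists for every \<open>s\<close>; only the outer one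
  depends on the convergence of \<open>p\<close>.\<close>

lemma double_limit:
  obtains h where "computable X (\<lambda>z. h (pi1 z) (pi1 (pi2 z)) (pi2 (pi2 z)))"
    and "\<And>x v. run (jump (jump X)) p x = Some v \<Longrightarrow>
      \<forall>\<^sub>F s in sequentially. \<forall>\<^sub>F t in sequentially. h x s t = v"
proof -
  obtain f where f: "computable (jump X) (\<lambda>z. f (pi1 z) (pi2 z))"
    "\<And>x v. run (jump (jump X)) p x = Some v \<Longrightarrow> \<forall>\<^sub>F s in sequentially. f x s = v"
    using limit_lemma by blast
  then obtain q where q: "\<And>z. run (jump X) q z = Some (f (pi1 z) (pi2 z))"
    unfolding computable_def by blast
  obtain g where g: "computable X (\<lambda>z. g (pi1 z) (pi2 z))"
    "\<And>x v. run (jump X) q x = Some v \<Longrightarrow> \<forall>\<^sub>F t in sequentially. g x t = v"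
    using limit_lemma by blast
  have "\<forall>\<^sub>F t in sequentially. g (pair x s) t = f x s" for x s
    using g(2) q[of "pair x s"] by simp
  then have "\<forall>\<^sub>F s in sequentially. \<forall>\<^sub>F t in sequentially. g (pair x s) t = v"
    if "run (jump (jump X)) p x = Some v" for x v
    using f(2)[OF that] by (auto elim!: eventually_mono)
  moreover have "computable X (\<lambda>z. g (pair (pi1 z) (pi1 (pi2 z))) (pi2 (pi2 z)))"
    by (intro comp_intros computable_comp2[OF g(1)])
  ultimately show thesis using that[of "\<lambda>x s t. g (pair x s) t"] by blast
qed

text \<open>For each \<open>x\<close> there is a program that ignores its input and searches for a
  witness for \<open>x\<close>. Its index is computable from \<open>x\<close>, and it lies in the
  jump exactly when a witness exists.\<close>

lemma decidable_jump_Ex: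
  assumes "decidable X (\<lambda>z. R (pi1 z) (pi2 z))"
  shows "decidable (jump X) (\<lambda>x. \<exists>w. R x w)"
proof -
  obtain p where p: "\<And>z. run X p z = Some (of_bool (\<not> R (pi1 z) (pi2 z)))"
    using decidable_not[OF assms] unfolding computable_def by blast
  define i where "i x = index (Comp (Mu p) (const_prog x))" for x
  have "i x \<in> jump X \<longleftrightarrow> run X (Comp (Mu p) (const_prog x)) (i x) \<noteq> None" for x
    unfolding jump_def i_def using bij_index by (auto simp: bij_def inj_eq simp del: index.simps)
  then have mem: "i x \<in> jump X \<longleftrightarrow> (\<exists>w. R x w)" for x
    using run_Mu_total[OF p] by (simp del: run.simps(9))
  \<comment> \<open>By the numbering, 6 is the offset of \<open>Comp\<close> and 1 the index of
    \<open>Succ\<close>.\<close>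
  have ci: "index (const_prog n) = rec_nat 0 (\<lambda>_ r. 6 + 4 * pair 1 r) n" for n
    by (induction n) auto
  have "computable (jump X) (\<lambda>x. index (const_prog x))"
    unfolding ci by (intro comp_intros)
  then have "computable (jump X) i"
    unfolding i_def[abs_def] index.simps by (intro comp_intros)
  then show ?thesis using decidable_oracle[of "jump X" i] by (simp add: mem)
qed


section \<open>Cohesive sets\<close>

text \<open>Cohesiveness supplies an eventual color for every \<open>x\<close>, so \<open>T\<close>
  is total even where \<open>q\<close> diverges; where the double limit exists, it fixes that
  color.\<close>

lemma two_r_cohesive_extension:
  assumes A: "two_r_cohesive A"
  obtains T where "computable (jump A) T"
    and "\<And>x v. run (jump (jump {})) q x = Some v \<Longrightarrow> T x = of_bool (v \<noteq> 0)"
proof -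
  obtain h where h: "computable {} (\<lambda>z. h (pi1 z) (pi1 (pi2 z)) (pi2 (pi2 z)))"
    and lim: "\<And>x v. run (jump (jump {})) q x = Some v \<Longrightarrow>
      \<forall>\<^sub>F s in sequentially. \<forall>\<^sub>F t in sequentially. h x s t = v"
    using double_limit by blast
  \<comment> \<open>Before its limits are reached \<open>h\<close> may take any value; truncation
    makes every stage a two-coloring.\<close>
  define c where "c x s t = (of_bool (h x s t \<noteq> 0) :: nat)" for x s t
  have c: "computable {} (\<lambda>z. c (pi1 z) (pi1 (pi2 z)) (pi2 (pi2 z)))"
    unfolding c_def by (intro comp_intros h)
  have inf: "infinite A" using A by (simp add: two_r_cohesive_def)
  \<comment> \<open>A number \<open>k\<close> codes a guess: from \<open>pi1 k\<close> on, all pairs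
    from \<open>A\<close> have color \<open>pi2 k\<close>. A counterexample \<open>w\<close> codes a
    pair from \<open>A\<close>, so refuting a guess is an existential question over
    \<open>A\<close>.\<close>
  define bad where "bad x k = (\<exists>w. pi1 w \<in> A \<and> pi2 w \<in> A \<and> pi1 k \<le> pi1 w \<and>
    pi1 w < pi2 w \<and> c x (pi1 w) (pi2 w) \<noteq> pi2 k)" for x k
  have good: "c x s t = pi2 k" if "\<not> bad x k" "s \<in> A" "t \<in> A" "pi1 k \<le> s" "s < t" for x k s t
    using that unfolding bad_def by (metis prod_encode_inverse fst_conv snd_conv)
  have ex: "\<exists>k. \<not> bad x k" for x
  proof -
    define C where "C S = c x (Min S) (Max S)" for S
    have C: "C {s, t} = c x s t" if "s < t" for s t
      using that by (simp add: C_def min_absorb1 max_absorb2)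
    have "two_coloring C"
      by (auto simp: two_coloring_def C_def c_def)
    moreover have "computable_coloring C"
    proof -
      have "computable {} (\<lambda>z. c x (pi1 z) (pi2 z))"
        using computable_comp[OF c, of "\<lambda>z. pair x z"] by (simp add: comp_intros)
      then obtain p where "\<And>z. run {} p z = Some (c x (pi1 z) (pi2 z))"
        unfolding computable_def by blast
      then show ?thesis unfolding computable_coloring_def by (intro exI[of _ p]) (simp add: C)
    qed
    ultimately have "almost_homogeneous A C" using A by (simp add: two_r_cohesive_def)
    then obtain F d where F: "finite F" "\<And>S. S \<in> nsets (A - F) 2 \<Longrightarrow> C S = d"
      unfolding almost_homogeneous_def by blast
    \<comment> \<open>Elements of \<open>A\<close> from \<open>n\<close> on avoid the exceptional
      set \<open>F\<close>, so \<open>pair n d\<close> is a correct guess.\<close>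
    obtain n where n: "\<forall>m\<in>F. m < n" using F(1) finite_nat_set_iff_bounded by blast
    have "c x s t = d" if "s \<in> A" "t \<in> A" "n \<le> s" "s < t" for s t
    proof -
      have "{s, t} \<in> nsets (A - F) 2" using that n by (auto simp: nsets_def)
      with F(2) C that show ?thesis by metis
    qed
    then have "\<not> bad x (pair n d)" by (auto simp: bad_def)
    then show ?thesis by blast
  qed
  define T where "T x = pi2 (LEAST k. \<not> bad x k)" for x
  have cA: "computable A (\<lambda>z. c (pi1 z) (pi1 (pi2 z)) (pi2 (pi2 z)))"
    using computable_turing_le[OF c] turing_le_iff_decidable computable_const by simp
  have "decidable A (\<lambda>z. pi1 (pi2 z) \<in> A \<and> pi2 (pi2 z) \<in> A \<and> pi1 (pi2 (pi1 z)) \<le> pi1 (pi2 z) \<and>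
      pi1 (pi2 z) < pi2 (pi2 z) \<and> c (pi1 (pi1 z)) (pi1 (pi2 z)) (pi2 (pi2 z)) \<noteq> pi2 (pi2 (pi1 z)))"
    using computable_comp[OF cA, of "\<lambda>z. pair (pi1 (pi1 z)) (pi2 z)"]
    by (intro comp_intros) (simp_all add: comp_intros)
  from decidable_jump_Ex[OF this[unfolded prod.collapse]]
  have "decidable (jump A) (\<lambda>z. bad (pi1 z) (pi2 z))"
    unfolding bad_def .
  then have "computable (jump A) T"
    unfolding T_def[abs_def] by (intro comp_intros computable_Least ex)
  moreover have "T x = of_bool (v \<noteq> 0)" if v: "run (jump (jump {})) q x = Some v" for x v
  proof -
    define k where "k = (LEAST k. \<not> bad x k)"
    have k: "\<not> bad x k" unfolding k_def using ex by (rule LeastI_ex)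
    obtain n where n: "\<And>s. n \<le> s \<Longrightarrow> \<forall>\<^sub>F t in sequentially. h x s t = v"
      using lim[OF v] by (auto simp: eventually_sequentially)
    \<comment> \<open>As \<open>A\<close> is infinite, it contains \<open>s\<close> beyond both the
      bound of the guess and the outer stage, and then \<open>t\<close> beyond \<open>s\<close> and
      the inner stage; the color of this pair is both the guessed color and the limit.\<close>
    obtain s where s: "s \<in> A" "max n (pi1 k) \<le> s" using inf infinite_nat_iff_unbounded_le by blast
    then obtain m where m: "\<And>t. m \<le> t \<Longrightarrow> h x s t = v"
      using n[of s] by (auto simp: eventually_sequentially)
    obtain t where t: "t \<in> A" "max m (Suc s) \<le> t" using inf infinite_nat_iff_unbounded_le by blast
    have "c x s t = pi2 k" using good[OF k] s t by auto
    then show ?thesis using m[of t] t by (simp add: T_def k_def c_def)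
  qed
  ultimately show thesis using that by blast
qed

theorem theorem3p13:
  fixes A :: "nat set"
  assumes "two_r_cohesive A"
  shows "jump (jump {}) <\<^sub>T jump A"
proof -
  let ?Z = "jump (jump {})"
  have "?Z \<le>\<^sub>T jump A"
  proof -
    obtain T where T: "computable (jump A) T"
      "\<And>x v. run ?Z Oracle x = Some v \<Longrightarrow> T x = of_bool (v \<noteq> 0)"
      using two_r_cohesive_extension[OF assms] by blast
    \<comment> \<open>The program \<open>Oracle\<close> converges everywhere, so the extension is
      the characteristic function itself.\<close>
    then have "T = (\<lambda>x. of_bool (x \<in> ?Z))" by (auto simp: fun_eq_iff)
    with T(1) show ?thesis by (simp add: turing_le_iff_decidable)
  qed
  moreover have "\<not> jump A \<le>\<^sub>T ?Z"
  proof
    assume le: "jump A \<le>\<^sub>T ?Z"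
    obtain u where u: "\<And>p v. run ?Z p (index p) = Some v \<Longrightarrow> run ?Z u (index p) = Some v"
      using universal_diagonal by blast
    obtain T where T: "computable (jump A) T"
      "\<And>x v. run ?Z u x = Some v \<Longrightarrow> T x = of_bool (v \<noteq> 0)"
      using two_r_cohesive_extension[OF assms] by blast
    \<comment> \<open>At its own index a program for \<open>1 - T\<close> is copied by
      \<open>u\<close>, so there \<open>T\<close> would be 1 if it is 0, and 0 if it is
      positive.\<close>
    have "computable ?Z (\<lambda>x. 1 - T x)"
      by (intro comp_intros computable_turing_le[OF T(1) le])
    then obtain p where p: "\<And>x. run ?Z p x = Some (1 - T x)"
      unfolding computable_def by blast
    have "T (index p) = of_bool (1 - T (index p) \<noteq> 0)" using T(2)[OF u[OF p]] .
    then show False by (cases "T (index p)") auto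
  qed
  ultimately show ?thesis by (simp add: turing_less_def)
qed

end
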